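(* Let $G$ be a connected graph. Then $\rho(G)=0$ if and only if $G$ is a caterpillar.
   Context: A caterpillar is a tree in which every vertex is within distance $1$ of some fixed path (the backbone). Patrol game with radius of capture $\rho\ge 0$ on a connected graph $G$: there is one cop and one robber. Before the game the cop fixes a walk in $G$ (his patrol: a sequence of vertices in which consecutive vertices are equal or adjacent), and the robber knows the entire patrol in advance, while the cop has no information about the robber. The cop starts at the first vertex of his patrol, then the robber chooses a starting vertex; afterwards the players alternate moves (cop first), the cop following his patrol and the robber moving to an adjacent vertex or staying put. The cop wins if at some moment the distance between the cop and the robber is at most $\rho$; otherwise the robber wins. $\rho(G)$ is the minimum $\rho\ge0$ for which the cop has a patrol capturing the robber regardless of the robber's play. *)

theory Defs
  imports "Graph_Theory.Graph_Theory"
begin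

text \<open>
  The locale \<^locale>\<open>graph\<close> describes finite simple graphs: finite symmetric digraphs
  without loops and parallel arcs, each undirected edge being a pair of opposite arcs.
\<close>

context graph
begin

definition gdist :: "'a \<Rightarrow> 'a \<Rightarrow> ereal" where
  "gdist u v = \<mu> (\<lambda>_. 1) u v"

text \<open>
  The bound on the length excludes the closed walks \<open>u, v, u\<close>, which the library counts as
  cycles of a symmetric digraph. (For the same reason the library's \<^const>\<open>tree\<close> cannot be
  used: no symmetric digraph with an edge satisfies it.)
\<close>

definition undirected_cycle :: "'b awalk \<Rightarrow> bool" where
  "undirected_cycle p \<longleftrightarrow> cycle p \<and> 3 \<le> length p"

definition undirected_tree :: bool where
  "undirected_tree \<longleftrightarrow> Digraph_Component.connected G \<and> (\<nexists>p. undirected_cycle p)"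

definition caterpillar :: bool where
  "caterpillar \<longleftrightarrow> undirected_tree \<and>
     (\<exists>p. vpath p G \<and> (\<forall>v \<in> verts G. \<exists>w \<in> set p. gdist v w \<le> 1))"

text \<open>
  Walks of the players are infinite sequences; a patrol of finite length is one that is
  eventually constant.
\<close>

definition lazy_walk :: "(nat \<Rightarrow> 'a) \<Rightarrow> bool" where
  "lazy_walk w \<longleftrightarrow>
     (\<forall>n. w n \<in> verts G) \<and> (\<forall>n. w (Suc n) = w n \<or> w n \<rightarrow>\<^bsub>G\<^esub> w (Suc n))"

text \<open>
  The positions in the order of play are \<open>c 0, r 0, c 1, r 1, c 2, \<dots>\<close>, so the cop at \<open>c n\<close>
  meets the robber at \<open>r n\<close> (after the robber's move) and the cop at \<open>c (Suc n)\<close> meets the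
  robber at \<open>r n\<close> (after the cop's move).
\<close>

definition captures :: "nat \<Rightarrow> (nat \<Rightarrow> 'a) \<Rightarrow> (nat \<Rightarrow> 'a) \<Rightarrow> bool" where
  "captures \<rho> c r \<longleftrightarrow>
     (\<exists>n. gdist (c n) (r n) \<le> ereal (real \<rho>) \<or> gdist (c (Suc n)) (r n) \<le> ereal (real \<rho>))"

text \<open>
  The robber knows the fixed patrol \<open>c\<close> and the cop does not react to him, so a way for the
  robber to play against \<open>c\<close> amounts to a single walk \<open>r\<close>, which may depend on all of \<open>c\<close>.
\<close>

definition winning_patrol :: "nat \<Rightarrow> (nat \<Rightarrow> 'a) \<Rightarrow> bool" where
  "winning_patrol \<rho> c \<longleftrightarrow> lazy_walk c \<and> (\<forall>r. lazy_walk r \<longrightarrow> captures \<rho> c r)"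

text \<open>Distances are integers, so only integral radii of capture matter.\<close>

definition patrol_radius :: nat where
  "patrol_radius = (LEAST \<rho>. \<exists>c. winning_patrol \<rho> c)"

text \<open>The minimum is attained in connected graphs: a large radius lets the cop stay put.\<close>

lemma ex_winning_patrol:
  assumes "Digraph_Component.connected G"
  shows "\<exists>\<rho> c. winning_patrol \<rho> c"
proof -
  have sc: "strongly_connected G"
    using symmetric_connected_imp_strongly_connected[OF sym_arcs assms] .
  then obtain v where v: "v \<in> verts G"
    unfolding strongly_connected_def by blast
  have "\<exists>k::nat. gdist v u \<le> ereal (real k)" if "u \<in> verts G" for u
  proof -
    from sc v that have "v \<rightarrow>\<^sup>* u"
      unfolding strongly_connected_def by blast
    then obtain p where "awalk v p u"
      by (auto simp: reachable_awalk)
    then have "gdist v u \<le> ereal (awalk_cost (\<lambda>_. 1) p)"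
      unfolding gdist_def by (rule min_cost_le_walk_cost)
    also have "awalk_cost (\<lambda>_. 1) p = real (length p)"
      by (simp add: awalk_cost_def sum_list_triv)
    finally show ?thesis by blast
  qed
  then obtain k :: "'a \<Rightarrow> nat" where k: "\<And>u. u \<in> verts G \<Longrightarrow> gdist v u \<le> ereal (real (k u))"
    by metis
  define \<rho> where "\<rho> = Max (k ` verts G)"
  have "gdist v u \<le> ereal (real \<rho>)" if "u \<in> verts G" for u
  proof -
    have "k u \<le> \<rho>"
      unfolding \<rho>_def using that by simp
    then show ?thesis
      using k[OF that] by (meson ereal_less_eq(3) of_nat_mono order_trans)
  qed
  then have "winning_patrol \<rho> (\<lambda>_. v)"
    unfolding winning_patrol_def captures_def lazy_walk_def using v by blast
  then show ?thesis by blast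
qed

end

end

theory Submission
  imports Defs
begin

text \<open>
  A winning patrol of radius 0 rules out cycles, since a robber on a cycle always has
  two ways to dodge. If a longest path is not a backbone, a vertex next to it has a neighbour at
  distance 2 from it; by maximality the path extends at least two steps to either side of the
  attachment vertex \<open>z\<close>, so \<open>z\<close> is the centre of a spider with three legs of length 2. The robber,
  knowing the patrol, uses the only moments when the cop is deep inside one branch at \<open>z\<close> to
  switch to a branch which is neither this one nor the next one the cop will enter deeply.
  Conversely, in a caterpillar the cop sweeps the backbone, visiting all leaves at each backbone
  vertex before moving on; whatever lies behind him stays free of the robber.
\<close>

section \<open>The robber's choice of branch\<close>

text \<open>
  At time \<open>n\<close> the cop is deep inside branch \<open>br n\<close> if \<open>D n\<close>; the robber's branch \<open>x n\<close> changes only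
  directly after such times.
\<close>

lemma ex_hideout:
  fixes D :: "nat \<Rightarrow> bool" and br :: "nat \<Rightarrow> nat"
  obtains x :: "nat \<Rightarrow> nat" where "\<And>n. x n < 3" "\<And>n. D n \<Longrightarrow> x n \<noteq> br n"
    "\<And>n. D n \<Longrightarrow> x (Suc n) \<noteq> br n" "\<And>n. \<not> D n \<Longrightarrow> x (Suc n) = x n"
proof -
  \<comment> \<open>\<open>nxt n\<close> is the branch of the first deep moment from
    \<open>n\<close> on. If there is none, the \<open>LEAST\<close> is an unspecified number, but
    \<open>nxt_Suc\<close> still holds because it only compares the two predicates.\<close>
  define nxt where "nxt n = br (LEAST k. n \<le> k \<and> D k)" for n
  have nxt_D: "nxt n = br n" if "D n" for n
    using that unfolding nxt_def by (metis (mono_tags, lifting) Least_equality order_refl)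
  have nxt_Suc: "nxt (Suc n) = nxt n" if "\<not> D n" for n
  proof -
    have "(\<lambda>k. Suc n \<le> k \<and> D k) = (\<lambda>k. n \<le> k \<and> D k)"
      using that by (metis Suc_leD le_antisym not_less_eq_eq)
    then show ?thesis unfolding nxt_def by simp
  qed
  have "\<exists>k<3. k \<noteq> i \<and> k \<noteq> j" for i j :: nat
    by presburger
  then obtain pick :: "nat \<Rightarrow> nat \<Rightarrow> nat"
    where pick: "\<And>i j. pick i j < 3" "\<And>i j. pick i j \<noteq> i" "\<And>i j. pick i j \<noteq> j"
    by metis
  \<comment> \<open>Right after a deep moment the new branch avoids both the one just visited and
    the next one to be visited; three branches leave room for this. The invariant is
    \<open>x n \<noteq> nxt n\<close>.\<close>
  define x where "x = rec_nat (pick (nxt 0) (nxt 0))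
    (\<lambda>n y. if D n then pick (br n) (nxt (Suc n)) else y)"
  have x_0: "x 0 = pick (nxt 0) (nxt 0)"
    and x_Suc: "x (Suc n) = (if D n then pick (br n) (nxt (Suc n)) else x n)" for n
    by (simp_all add: x_def)
  have "x n < 3 \<and> x n \<noteq> nxt n" for n
    by (induction n) (use pick in \<open>auto simp: x_0 x_Suc nxt_Suc\<close>)
  then show ?thesis
    by (intro that[of x]) (auto simp: x_Suc pick nxt_D[symmetric])
qed

lemma vwalk_nth_adj:
  assumes "vwalk p G" "Suc i < length p"
  shows "p ! i \<rightarrow>\<^bsub>G\<^esub> p ! Suc i"
proof -
  have "(p ! i, p ! Suc i) \<in> set (vwalk_arcs p)"
    using assms(2)
  proof (induction p arbitrary: i rule: vwalk_arcs.induct)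
    case (3 x y xs)
    then show ?case by (cases i) auto
  qed auto
  then show ?thesis
    using assms by blast
qed

section \<open>Distances and capture at radius 0\<close>

context graph
begin

lemma adj_sym: "u \<rightarrow>\<^bsub>G\<^esub> v \<Longrightarrow> v \<rightarrow>\<^bsub>G\<^esub> u"
  by (rule arcs_ends_symmetric[OF sym_arcs])

text \<open>\<open>gdist\<close> is an infimum of walk lengths, which are integers: if every walk is
  longer than \<open>k\<close>, the infimum is at least \<open>k + 1\<close>. This includes the case
  of no walk, where it is infinite.\<close>

lemma ex_short_awalk:
  assumes "gdist u v \<le> real k"
  shows "\<exists>p. awalk u p v \<and> length p \<le> k"
proof (rule ccontr)
  assume *: "\<nexists>p. awalk u p v \<and> length p \<le> k"
  have "ereal (real (Suc k)) \<le> gdist u v"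
    unfolding gdist_def \<mu>_def
  proof (rule INF_greatest)
    fix p assume "p \<in> {p. awalk u p v}"
    with * have "Suc k \<le> length p" by auto
    then show "ereal (real (Suc k)) \<le> ereal (awalk_cost (\<lambda>_. 1) p)"
      by (simp add: awalk_cost_def sum_list_triv)
  qed
  then have "ereal (real (Suc k)) \<le> ereal (real k)"
    using assms by (rule order_trans)
  then show False by simp
qed

lemma gdist_le_length:
  assumes "awalk u p v"
  shows "gdist u v \<le> real (length p)"
  using min_cost_le_walk_cost[OF assms, of "\<lambda>_. 1"]
  by (simp add: gdist_def awalk_cost_def sum_list_triv)

lemma gdist_le_0_iff: "u \<in> verts G \<Longrightarrow> gdist u v \<le> 0 \<longleftrightarrow> u = v"
  using ex_short_awalk[of u v 0] gdist_le_length[of u "[]" v]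
  by (auto simp: awalk_Nil_iff zero_ereal_def)

lemma gdist_le_1_iff: "u \<in> verts G \<Longrightarrow> gdist u v \<le> 1 \<longleftrightarrow> u = v \<or> u \<rightarrow>\<^bsub>G\<^esub> v"
proof
  assume "gdist u v \<le> 1"
  then obtain p where p: "awalk u p v" "length p \<le> 1"
    using ex_short_awalk[of u v 1] by (auto simp: one_ereal_def)
  show "u = v \<or> u \<rightarrow>\<^bsub>G\<^esub> v"
  proof (cases p)
    case (Cons e es)
    with p have "p = [e]" by simp
    with p show ?thesis
      by (auto simp: awalk_simps intro: in_arcs_imp_in_arcs_ends)
  qed (use p in \<open>simp add: awalk_simps\<close>)
next
  assume u: "u \<in> verts G" and "u = v \<or> u \<rightarrow>\<^bsub>G\<^esub> v"
  then show "gdist u v \<le> 1"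
  proof (elim disjE)
    assume "u = v"
    then have "gdist u v \<le> 0" using u by (simp add: gdist_le_0_iff)
    then show ?thesis by (rule order_trans) simp
  next
    assume "u \<rightarrow>\<^bsub>G\<^esub> v"
    then obtain e where "e \<in> arcs G" "tail G e = u" "head G e = v" by auto
    then have "awalk u [e] v" by (auto simp: awalk_simps)
    from gdist_le_length[OF this] show ?thesis by (simp add: one_ereal_def)
  qed
qed

lemma captures_0_iff:
  assumes "lazy_walk c"
  shows "captures 0 c r \<longleftrightarrow> (\<exists>n. c n = r n \<or> c (Suc n) = r n)"
  using assms unfolding captures_def lazy_walk_def
  by (simp add: zero_ereal_def[symmetric] gdist_le_0_iff)

text \<open>Connectedness guarantees that some radius is attained, so that the \<open>LEAST\<close>
  really has a winning patrol.\<close>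

lemma patrol_radius_eq_0_iff:
  assumes "Digraph_Component.connected G"
  shows "patrol_radius = 0 \<longleftrightarrow> (\<exists>c. winning_patrol 0 c)"
proof
  assume "patrol_radius = 0"
  then show "\<exists>c. winning_patrol 0 c"
    using LeastI_ex[OF ex_winning_patrol[OF assms]] unfolding patrol_radius_def by simp
next
  assume "\<exists>c. winning_patrol 0 c"
  then show "patrol_radius = 0"
    unfolding patrol_radius_def by (rule Least_eq_0)
qed

section \<open>Evasion on cycles\<close>

lemma not_winning_patrol_0I:
  assumes "lazy_walk r" "\<And>n. r n \<noteq> c n" "\<And>n. r n \<noteq> c (Suc n)"
  shows "\<not> winning_patrol 0 c"
  using assms unfolding winning_patrol_def by (metis captures_0_iff)

text \<open>The robber sees one move ahead and leaves his vertex only when the cop is about to step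
  on it. Of his two neighbours in \<open>X\<close>, at least one is not the cop's current vertex. At
  the start, \<open>x\<close>, \<open>y\<close>, \<open>z\<close> are distinct and the cop blocks at
  most two of them.\<close>

lemma evade_min_degree_2:
  assumes "X \<subseteq> verts G" "X \<noteq> {}"
    and two: "\<And>x. x \<in> X \<Longrightarrow> \<exists>y\<in>X. \<exists>z\<in>X. y \<noteq> z \<and> x \<rightarrow>\<^bsub>G\<^esub> y \<and> x \<rightarrow>\<^bsub>G\<^esub> z"
  shows "\<not> winning_patrol 0 c"
proof -
  have "\<exists>r. \<forall>n. (r n \<in> X \<and> r n \<noteq> c n \<and> r n \<noteq> c (Suc n)) \<and>
    (r (Suc n) = r n \<or> r n \<rightarrow>\<^bsub>G\<^esub> r (Suc n))"
  proof (rule dependent_nat_choice)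
    from assms(2) obtain x where "x \<in> X" by blast
    with two obtain y z where "y \<in> X" "z \<in> X" "y \<noteq> z" "x \<rightarrow>\<^bsub>G\<^esub> y" "x \<rightarrow>\<^bsub>G\<^esub> z" by blast
    moreover from this have "x \<noteq> y" "x \<noteq> z" using adj_not_same by blast+
    ultimately show "\<exists>v. v \<in> X \<and> v \<noteq> c 0 \<and> v \<noteq> c (Suc 0)"
      using \<open>x \<in> X\<close> by metis
  next
    fix v n assume v: "v \<in> X \<and> v \<noteq> c n \<and> v \<noteq> c (Suc n)"
    show "\<exists>w. (w \<in> X \<and> w \<noteq> c (Suc n) \<and> w \<noteq> c (Suc (Suc n))) \<and> (w = v \<or> v \<rightarrow>\<^bsub>G\<^esub> w)"
    proof (cases "c (Suc (Suc n)) = v")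
      case True
      from two v obtain w where "w \<in> X" "v \<rightarrow>\<^bsub>G\<^esub> w" "w \<noteq> c (Suc n)" by metis
      then show ?thesis using True adj_not_same by blast
    qed (use v in metis)
  qed
  then obtain r where r: "\<And>n. r n \<in> X" "\<And>n. r n \<noteq> c n" "\<And>n. r n \<noteq> c (Suc n)"
    "\<And>n. r (Suc n) = r n \<or> r n \<rightarrow>\<^bsub>G\<^esub> r (Suc n)"
    by metis
  then show ?thesis
    using assms(1) by (intro not_winning_patrol_0I[of r]) (auto simp: lazy_walk_def)
qed

text \<open>On a cycle with at least three arcs the predecessor and the successor of each vertex
  differ, so its vertex set can serve as \<open>X\<close>.\<close>

lemma undirected_cycle_no_winning_patrol:
  assumes "undirected_cycle p"
  shows "\<not> winning_patrol 0 c"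
proof -
  from assms obtain u where u: "awalk u p u" "distinct (tl (awalk_verts u p))"
    and n: "3 \<le> length p"
    unfolding undirected_cycle_def cycle_def by blast
  define q where "q i = awalk_verts u p ! i" for i
  let ?n = "length p"
  have len: "length (awalk_verts u p) = Suc ?n"
    by (simp add: length_awalk_verts)
  have adj: "q i \<rightarrow>\<^bsub>G\<^esub> q (Suc i)" if "i < ?n" for i
  proof -
    have "p ! i \<in> arcs G"
      using u(1) that by (auto simp: awalk_def)
    moreover have "q i = tail G (p ! i)"
      using that by (auto simp: q_def awalk_verts_conv nth_append)
    moreover have "q (Suc i) = head G (p ! i)"
      using that u(1) by (auto simp: q_def awalk_verts_conv' awalk_def)
    ultimately show ?thesis
      by (simp add: in_arcs_imp_in_arcs_ends)
  qed
  have "hd (awalk_verts u p) = last (awalk_verts u p)"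
    using u(1) by simp
  then have closed: "q 0 = q ?n"
    unfolding q_def by (metis awalk_verts_non_Nil diff_Suc_1 hd_conv_nth last_conv_nth len)
  have inj: "q i \<noteq> q j" if "i \<noteq> j" "1 \<le> i" "1 \<le> j" "i \<le> ?n" "j \<le> ?n" for i j
  proof -
    have "tl (awalk_verts u p) ! (i - 1) \<noteq> tl (awalk_verts u p) ! (j - 1)"
      using that len by (subst nth_eq_iff_index_eq[OF u(2)]) auto
    then show ?thesis
      using that len by (simp add: q_def nth_tl)
  qed
  show ?thesis
  proof (rule evade_min_degree_2)
    show "q ` {1..?n} \<subseteq> verts G"
    proof
      fix x assume "x \<in> q ` {1..?n}"
      then obtain i where "x = q i" "1 \<le> i" "i \<le> ?n" by auto
      then show "x \<in> verts G" using adj[of "i - 1"] adj_in_verts(2)[of "q (i - 1)" x] by simp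
    qed
    show "q ` {1..?n} \<noteq> {}" using n by auto
  next
    fix x assume "x \<in> q ` {1..?n}"
    then obtain i where i: "x = q i" "1 \<le> i" "i \<le> ?n" by auto
    \<comment> \<open>Cyclic predecessor and successor. Indices run from 1 to \<open>?n\<close>
      because \<open>q 0 = q ?n\<close>, so each vertex of the cycle is counted once.\<close>
    define j k where "j = (if i = 1 then ?n else i - 1)" and "k = (if i = ?n then 1 else Suc i)"
    have "p \<noteq> []" using n by auto
    have jk: "j \<in> {1..?n}" "k \<in> {1..?n}" "j \<noteq> k"
      using i n by (auto simp: j_def k_def)
    have "q j \<rightarrow>\<^bsub>G\<^esub> x"
      using adj[of "i - 1"] i closed \<open>p \<noteq> []\<close> by (auto simp: j_def)
    moreover have "x \<rightarrow>\<^bsub>G\<^esub> q k"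
      using adj[of i] adj[of 0] i closed \<open>p \<noteq> []\<close> by (auto simp: k_def)
    ultimately show "\<exists>y\<in>q ` {1..?n}. \<exists>z\<in>q ` {1..?n}. y \<noteq> z \<and> x \<rightarrow>\<^bsub>G\<^esub> y \<and> x \<rightarrow>\<^bsub>G\<^esub> z"
      using jk inj[of j k] adj_sym
      by (intro bexI[of _ "q j"] bexI[of _ "q k"]) auto
  qed
qed

section \<open>Evasion on a spider with three legs of length 2\<close>

lemma arcs_ends_del_vert: "(u, v) \<in> arcs_ends (del_vert z) \<longleftrightarrow> u \<rightarrow>\<^bsub>G\<^esub> v \<and> u \<noteq> z \<and> v \<noteq> z"
  by (auto simp: arcs_ends_conv del_vert_simps)

lemma reachable_del_vert_sym:
  assumes "u \<rightarrow>\<^sup>*\<^bsub>del_vert z\<^esub> v"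
  shows "v \<rightarrow>\<^sup>*\<^bsub>del_vert z\<^esub> u"
proof (rule symmetric_reachable[OF _ assms])
  show "symmetric (del_vert z)"
    unfolding symmetric_def by (auto simp: sym_def arcs_ends_del_vert intro: adj_sym)
qed

text \<open>A path from \<open>x\<close> to \<open>y\<close> avoiding \<open>z\<close> closes up
  through \<open>z\<close> to a cycle; if \<open>x \<noteq> y\<close>, the path has an arc and the
  cycle at least three. Thus each component of \<open>G - z\<close> is attached to \<open>z\<close>
  by at most one edge.\<close>

lemma acyclic_unique_neighbour:
  assumes acyclic: "\<nexists>p. undirected_cycle p"
    and "z \<rightarrow>\<^bsub>G\<^esub> x" "z \<rightarrow>\<^bsub>G\<^esub> y" "x \<rightarrow>\<^sup>*\<^bsub>del_vert z\<^esub> y"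
  shows "x = y"
proof (rule ccontr)
  assume "x \<noteq> y"
  interpret D: wf_digraph "del_vert z"
    by (rule wf_digraph_del_vert)
  \<comment> \<open>Deleting a vertex leaves \<open>tail\<close> and \<open>head\<close> unchanged,
    so walks of \<open>del_vert z\<close> can be read as walks of \<open>G\<close>.\<close>
  have verts_eq: "pre_digraph.awalk_verts (del_vert z) u p = awalk_verts u p" for u p
    by (simp add: awalk_verts_conv pre_digraph.awalk_verts_conv del_vert_simps)
  have cas_eq: "pre_digraph.cas (del_vert z) u p v = cas u p v" for u p v
    by (induction p arbitrary: u) (simp_all add: pre_digraph.cas.simps del_vert_simps)
  from assms(4) obtain p where p: "D.apath x p y"
    by (auto simp: D.reachable_apath)
  then have walk: "D.awalk x p y" and dist: "distinct (awalk_verts x p)"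
    by (simp_all add: D.apath_def verts_eq)
  have "set (awalk_verts x p) \<subseteq> verts (del_vert z)"
    using walk by (auto simp: D.awalk_conv verts_eq)
  then have z: "z \<notin> set (awalk_verts x p)"
    by (auto simp: del_vert_simps)
  have walk': "awalk x p y"
    using walk by (auto simp: D.awalk_def awalk_def cas_eq del_vert_simps)
  have "p \<noteq> []"
    using walk' \<open>x \<noteq> y\<close> by (auto simp: awalk_Nil_iff)
  from assms(2) obtain e where e: "e \<in> arcs G" "tail G e = z" "head G e = x" by auto
  from adj_sym[OF assms(3)] obtain f where f: "f \<in> arcs G" "tail G f = y" "head G f = z" by auto
  have "awalk x (p @ [f]) z"
    by (rule awalk_appendI[OF walk']) (use f in \<open>auto simp: awalk_simps\<close>)
  moreover from this have "awalk_verts x (p @ [f]) = awalk_verts x p @ [z]"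
    using f awlast_of_awalk[OF walk'] by (subst awalk_verts_append) auto
  ultimately have "awalk z (e # p @ [f]) z" "awalk_verts z (e # p @ [f]) = z # awalk_verts x p @ [z]"
    using e by (auto simp: awalk_Cons_iff)
  then have "cycle (e # p @ [f])"
    unfolding cycle_def using dist z by (intro exI[of _ z]) simp
  then have "undirected_cycle (e # p @ [f])"
    using \<open>p \<noteq> []\<close> by (cases p) (simp_all add: undirected_cycle_def)
  with acyclic show False by blast
qed

lemma evade_spider:
  assumes acyclic: "\<nexists>p. undirected_cycle p"
    and a: "\<And>i. i < 3 \<Longrightarrow> z \<rightarrow>\<^bsub>G\<^esub> a i" and b: "\<And>i. i < 3 \<Longrightarrow> a i \<rightarrow>\<^bsub>G\<^esub> b i"
    and bz: "\<And>i. i < 3 \<Longrightarrow> b i \<noteq> z" and inj: "inj_on a {..<3::nat}"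
  shows "\<not> winning_patrol 0 c"
proof
  assume win: "winning_patrol 0 c"
  interpret D: wf_digraph "del_vert z"
    by (rule wf_digraph_del_vert)
  \<comment> \<open>\<open>B i\<close> is the component of \<open>G - z\<close> containing \<open>a i\<close>; as \<open>G\<close> is acyclic, the \<open>B i\<close> are
    disjoint and can be entered or left only along the edge between \<open>z\<close> and \<open>a i\<close>.\<close>
  define B where "B i = {v. a i \<rightarrow>\<^sup>*\<^bsub>del_vert z\<^esub> v}" for i
  have z_B: "z \<notin> B i" for i
    using D.reachable_in_verts(2)[of "a i" z] by (auto simp: B_def del_vert_simps)
  have az: "a i \<noteq> z" if "i < 3" for i
    using a[OF that] adj_not_same by auto
  have a_B: "a i \<in> B i" if "i < 3" for i
    using a[OF that] az[OF that] adj_in_verts by (auto simp: B_def del_vert_simps)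
  have B_step: "v \<in> B i" if "u \<in> B i" "u \<rightarrow>\<^bsub>G\<^esub> v" "v \<noteq> z" for i u v
    using that z_B[of i] unfolding B_def
    by (auto simp: arcs_ends_del_vert intro: D.reachable_adj_trans)
  have B_exit: "u = a i" if "u \<in> B i" "u \<rightarrow>\<^bsub>G\<^esub> z" "i < 3" for i u
    using acyclic_unique_neighbour[OF acyclic a[OF that(3)] adj_sym[OF that(2)]] that(1)
    by (auto simp: B_def)
  have b_B: "b i \<in> B i" if "i < 3" for i
    using B_step a_B b bz that by blast
  have disj: "i = j" if "v \<in> B i" "v \<in> B j" "i < 3" "j < 3" for i j v
  proof -
    have "a i \<rightarrow>\<^sup>*\<^bsub>del_vert z\<^esub> a j"
      using that reachable_del_vert_sym D.reachable_trans unfolding B_def by blast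
    then have "a i = a j"
      using acyclic_unique_neighbour[OF acyclic] a that by blast
    then show ?thesis
      using inj that by (auto dest: inj_onD)
  qed
  have ab: "a i \<noteq> b i" if "i < 3" for i
    using b[OF that] adj_not_same by auto
  \<comment> \<open>From a deep position the cop cannot reach \<open>z\<close> in one move, so the
    robber may safely stand there.\<close>
  define deep where "deep v i \<longleftrightarrow> i < 3 \<and> v \<in> B i \<and> v \<noteq> a i" for v i
  have deep_unique: "i = j" if "deep v i" "deep v j" for v i j
    using that disj unfolding deep_def by blast
  define br where "br v = (SOME i. deep v i)" for v
  have br: "br v = i" if "deep v i" for v i
    unfolding br_def using that deep_unique by blast
  obtain x where x: "\<And>n. x n < 3" and x_next: "\<And>n i. deep (c n) i \<Longrightarrow> x n \<noteq> i"
    and x_last: "\<And>n i. deep (c n) i \<Longrightarrow> x (Suc n) \<noteq> i"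
    and x_Suc: "\<And>n. \<nexists>i. deep (c n) i \<Longrightarrow> x (Suc n) = x n"
    using ex_hideout[of "\<lambda>n. \<exists>i. deep (c n) i" "\<lambda>n. br (c n)"] br by metis
  have c: "lazy_walk c"
    using win by (simp add: winning_patrol_def)
  have c_step: "c (Suc n) = c n \<or> c n \<rightarrow>\<^bsub>G\<^esub> c (Suc n)" for n
    using c by (simp add: lazy_walk_def)
  have c_leave: "c n = a i \<and> c (Suc n) = z" if "c n \<in> B i" "c (Suc n) \<notin> B i" "i < 3" for n i
    using that c_step[of n] B_step B_exit by metis
  have c_enter: "c n = z \<and> c (Suc n) = a i" if "c n \<notin> B i" "c (Suc n) \<in> B i" "i < 3" for n i
    using that c_step[of n] B_step B_exit adj_sym by metis
  \<comment> \<open>While the cop is deep, the robber waits at \<open>z\<close>. While the cop is at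
    the foot \<open>a i\<close> of another branch, he stands at \<open>a (x n)\<close>, ready for
    \<open>z\<close> if the cop goes deep and for \<open>b (x n)\<close> if the cop turns back.
    Otherwise he hides at \<open>b (x n)\<close>, which only a cop deep in branch \<open>x n\<close>
    could occupy.\<close>
  define r where "r n = (if \<exists>i. deep (c n) i then z
    else if \<exists>i<3. i \<noteq> x n \<and> c n = a i then a (x n) else b (x n))" for n
  have b_deep: "deep (b i) i" if "i < 3" for i
    using that b_B[OF that] ab[OF that] by (simp add: deep_def)
  have r_verts: "r n \<in> verts G" for n
    using a[OF x[of n]] b[OF x[of n]] adj_in_verts by (auto simp: r_def)
  have "r n \<noteq> c n" for n
    using z_B b_deep[OF x[of n]] inj x[of n]
    by (auto simp: r_def deep_def dest: inj_onD)
  moreover have "r n \<noteq> c (Suc n)" for n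
  proof (cases "\<exists>i. deep (c n) i")
    case True
    then obtain i where "i < 3" "c n \<in> B i" "c n \<noteq> a i" by (auto simp: deep_def)
    then have "c (Suc n) \<in> B i" using c_leave by blast
    then show ?thesis using True z_B by (auto simp: r_def)
  next
    case shallow: False
    show ?thesis
    proof (cases "\<exists>i<3. i \<noteq> x n \<and> c n = a i")
      case True
      then obtain i where i: "i < 3" "i \<noteq> x n" "c n = a i" by blast
      have "c (Suc n) \<noteq> a (x n)"
      proof
        \<comment> \<open>Going from \<open>a i\<close> to another foot would mean leaving
          \<open>B i\<close> in one move, which ends at \<open>z\<close>.\<close>
        assume *: "c (Suc n) = a (x n)"
        then have "c (Suc n) \<notin> B i" using disj a_B i x by metis
        then show False using c_leave[of n i] a_B i az x * by metis
      qed
      then show ?thesis using True shallow by (simp add: r_def)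
    next
      case False
      \<comment> \<open>As the cop is not deep now, \<open>x (Suc n) = x n\<close>, and this branch
        is not the one he may be deep in next.\<close>
      have "c (Suc n) \<noteq> b (x n)"
        using x_next[of "Suc n"] x_Suc[OF shallow] b_deep[OF x[of n]] by metis
      moreover have "r n = b (x n)" unfolding r_def by (simp only: False shallow if_False)
      ultimately show ?thesis by metis
    qed
  qed
  moreover have "r (Suc n) = r n \<or> r n \<rightarrow>\<^bsub>G\<^esub> r (Suc n)" for n
  proof (cases "\<exists>i. deep (c n) i")
    case d1: True
    then obtain i where i: "deep (c n) i" by blast
    show ?thesis
    proof (cases "\<exists>i. deep (c (Suc n)) i")
      case False
      \<comment> \<open>A deep cop cannot leave \<open>B i\<close> at once, so he surfaces at its
        foot.\<close>
      have "c (Suc n) = a i"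
        using False i c_leave[of n i] by (auto simp: deep_def)
      then have "r (Suc n) = a (x (Suc n))"
        using False x_last[OF i] i by (auto simp: r_def deep_def)
      moreover have "r n = z" using d1 by (simp add: r_def)
      ultimately show ?thesis using a x by simp
    qed (use d1 in \<open>simp add: r_def\<close>)
  next
    case d1: False
    show ?thesis
    proof (cases "\<exists>i. deep (c (Suc n)) i")
      case True
      then obtain i where i: "deep (c (Suc n)) i" by blast
      \<comment> \<open>Entering \<open>B i\<close> from outside ends at its foot, which is not
        deep; so the cop was already there.\<close>
      have "c n = a i"
        using d1 i c_enter[of n i] by (auto simp: deep_def)
      then have "r n = a (x n)"
        using d1 x_next[OF i] x_Suc[OF d1] i by (auto simp: r_def deep_def)
      moreover have "r (Suc n) = z" using True by (simp add: r_def)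
      ultimately show ?thesis using a x adj_sym by simp
    next
      case False
      then show ?thesis
        using d1 x_Suc[OF d1] b[OF x[of n]] adj_sym by (auto simp: r_def)
    qed
  qed
  ultimately have "\<not> winning_patrol 0 c"
    using r_verts by (intro not_winning_patrol_0I[of r]) (auto simp: lazy_walk_def)
  with win show False by blast
qed

section \<open>Longest paths as backbones\<close>

lemma ex_longest_vpath:
  assumes "verts G \<noteq> {}"
  obtains p where "vpath p G" "\<And>q. vpath q G \<Longrightarrow> length q \<le> length p"
proof -
  from assms obtain v where "v \<in> verts G" by blast
  then have "vpath [v] G" by (auto simp: vpath_def vwalk_def)
  moreover have "length q \<le> card (verts G)" if "vpath q G" for q
    using that by (metis vpath_def vwalk_def card_mono distinct_card finite_verts)
  ultimately obtain p where "vpath p G" "\<forall>q. vpath q G \<longrightarrow> length q \<le> length p"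
    using ex_has_greatest_nat[of "\<lambda>p. vpath p G" "[v]" length "Suc (card (verts G))"]
    by (auto simp: less_Suc_eq_le)
  then show ?thesis using that by blast
qed

lemma vpath_Cons_iff: "p \<noteq> [] \<Longrightarrow> vpath (u # p) G \<longleftrightarrow> u \<rightarrow>\<^bsub>G\<^esub> hd p \<and> u \<notin> set p \<and> vpath p G"
  by (auto simp: vpath_def vwalk_def dest: adj_in_verts)

lemma vpath_append_iff:
  assumes "p \<noteq> []" "q \<noteq> []"
  shows "vpath (p @ q) G \<longleftrightarrow> vpath p G \<and> last p \<rightarrow>\<^bsub>G\<^esub> hd q \<and> vpath q G \<and> set p \<inter> set q = {}"
  using assms by (auto simp: vpath_def vwalk_def vwalk_arcs_append)

text \<open>One leg is \<open>z\<close>, \<open>x\<close>, \<open>u\<close>. The other two lie on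
  the longest path, since replacing either side of \<open>z\<close> by \<open>x\<close>,
  \<open>u\<close> would lengthen it if that side had fewer than two vertices.\<close>

lemma ex_spider:
  assumes "vpath p G" and longest: "\<And>q. vpath q G \<Longrightarrow> length q \<le> length p"
    and z: "z \<in> set p" and x: "z \<rightarrow>\<^bsub>G\<^esub> x" "x \<notin> set p" and u: "x \<rightarrow>\<^bsub>G\<^esub> u" "u \<notin> set p"
  obtains a b :: "nat \<Rightarrow> 'a" where "\<And>i. i < 3 \<Longrightarrow> z \<rightarrow>\<^bsub>G\<^esub> a i" "\<And>i. i < 3 \<Longrightarrow> a i \<rightarrow>\<^bsub>G\<^esub> b i"
    "\<And>i. i < 3 \<Longrightarrow> b i \<noteq> z" "inj_on a {..<3}"
proof -
  have in_V: "x \<in> verts G" "u \<in> verts G" "z \<in> verts G"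
    using x(1) u(1) adj_in_verts by blast+
  have ux: "u \<noteq> x" using u(1) adj_not_same by blast
  from z obtain p1 p2 where p: "p = p1 @ z # p2" by (auto simp: in_set_conv_decomp)
  have sing: "vpath [v] G" if "v \<in> verts G" for v
    using that by (auto simp: vpath_def vwalk_def)
  have p1z: "vpath (p1 @ [z]) G"
    using \<open>vpath p G\<close> sing[OF in_V(3)] unfolding p
    by (cases "p1 = []") (auto simp: vpath_append_iff)
  have zp2: "vpath (z # p2) G"
    using \<open>vpath p G\<close> unfolding p
    by (cases "p1 = []") (auto simp: vpath_append_iff)
  have "vpath (p1 @ [z] @ [x, u]) G"
    using p1z x u sing in_V ux vpath_append_iff[of "p1 @ [z]" "[x, u]"]
    by (auto simp: p vpath_Cons_iff)
  from longest[OF this] have len2: "2 \<le> length p2" by (simp add: p)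
  have "vpath (u # x # z # p2) G"
    using zp2 x u adj_sym ux by (auto simp: p vpath_Cons_iff)
  from longest[OF this] have len1: "2 \<le> length p1" by (simp add: p)
  obtain a2 b2 p2' where p2: "p2 = a2 # b2 # p2'"
    using len2 by (metis Suc_le_length_iff numeral_2_eq_2)
  obtain a1 b1 p1' where "rev p1 = a1 # b1 # p1'"
    using len1 by (metis Suc_le_length_iff numeral_2_eq_2 length_rev)
  then have p1: "p1 = rev p1' @ [b1, a1]"
    by (metis append.assoc append_Cons append_Nil rev.simps(2) rev_rev_ident)
  have arcs: "z \<rightarrow>\<^bsub>G\<^esub> a2" "a2 \<rightarrow>\<^bsub>G\<^esub> b2"
    using zp2 by (auto simp: p2 vpath_Cons_iff)
  have "vpath ([b1, a1] @ [z]) G"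
    using p1z unfolding p1 by (cases "p1' = []") (auto simp: vpath_append_iff)
  then have arcs': "b1 \<rightarrow>\<^bsub>G\<^esub> a1" "a1 \<rightarrow>\<^bsub>G\<^esub> z"
    by (auto simp: vpath_Cons_iff)
  have "distinct p" using \<open>vpath p G\<close> by (simp add: vpath_def)
  then have d: "a1 \<noteq> a2" "b1 \<noteq> z" "b2 \<noteq> z" "a1 \<noteq> x" "a2 \<noteq> x" "u \<noteq> z"
    using x u by (auto simp: p p1 p2)
  have i3: "i = 0 \<or> i = 1 \<or> i = 2" if "i < 3" for i :: nat
    using that by auto
  show ?thesis
  proof (rule that[of "\<lambda>i. [a1, a2, x] ! i" "\<lambda>i. [b1, b2, u] ! i"])
    show "inj_on (\<lambda>i. [a1, a2, x] ! i) {..<3}"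
      using d by (intro inj_on_nth) auto
  qed (use arcs arcs' x u d adj_sym in \<open>auto dest!: i3\<close>)
qed

text \<open>The closed neighbourhood \<open>N\<close> of a longest path is closed under adjacency,
  as an edge leaving it would create a spider; connectedness then makes it everything.\<close>

lemma winning_patrol_0_imp_caterpillar:
  assumes conn: "Digraph_Component.connected G" and win: "winning_patrol 0 c"
  shows "caterpillar"
proof -
  have acyclic: "\<nexists>p. undirected_cycle p"
    using win undirected_cycle_no_winning_patrol by blast
  have "strongly_connected G"
    using symmetric_connected_imp_strongly_connected[OF sym_arcs conn] .
  then have "verts G \<noteq> {}" and reach: "\<And>u v. u \<in> verts G \<Longrightarrow> v \<in> verts G \<Longrightarrow> u \<rightarrow>\<^sup>* v"
    by (auto simp: strongly_connected_def)
  then obtain p where p: "vpath p G" and longest: "\<And>q. vpath q G \<Longrightarrow> length q \<le> length p"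
    using ex_longest_vpath by blast
  define N where "N = {v. v \<in> set p \<or> (\<exists>w\<in>set p. w \<rightarrow>\<^bsub>G\<^esub> v)}"
  have N_step: "u \<in> N" if x: "x \<in> N" and xu: "x \<rightarrow>\<^bsub>G\<^esub> u" for x u
  proof (rule ccontr)
    assume "u \<notin> N"
    with x xu have "x \<notin> set p" "u \<notin> set p" by (auto simp: N_def)
    moreover from this x obtain z where "z \<in> set p" "z \<rightarrow>\<^bsub>G\<^esub> x" by (auto simp: N_def)
    ultimately obtain a b :: "nat \<Rightarrow> 'a" where "\<And>i. i < 3 \<Longrightarrow> z \<rightarrow>\<^bsub>G\<^esub> a i" "\<And>i. i < 3 \<Longrightarrow> a i \<rightarrow>\<^bsub>G\<^esub> b i"
      "\<And>i. i < 3 \<Longrightarrow> b i \<noteq> z" "inj_on a {..<3}"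
      using ex_spider[OF p longest] xu by metis
    then show False using evade_spider[OF acyclic] win by blast
  qed
  have p_V: "p \<noteq> []" "set p \<subseteq> verts G" using p by (auto simp: vpath_def vwalk_def)
  have "v \<in> N" if "v \<in> verts G" for v
  proof -
    have "hd p \<rightarrow>\<^sup>* v" using reach[of "hd p" v] p_V that hd_in_set[of p] by blast
    then show "v \<in> N"
    proof (induction rule: reachable_induct)
      case base then show ?case using p_V by (simp add: N_def)
    qed (rule N_step)
  qed
  then have "\<forall>v\<in>verts G. \<exists>w\<in>set p. gdist v w \<le> 1"
    using gdist_le_1_iff adj_sym unfolding N_def by blast
  then show ?thesis
    using p acyclic conn unfolding caterpillar_def undirected_tree_def by blast
qed

section \<open>Finite patrols that clear vertex sets\<close>

text \<open>
  \<open>clears u K\<close>: some finite patrol ending at \<open>u\<close> guarantees that an uncaptured robber is outside \<open>K\<close>.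
  In the second rule the cop moves to \<open>v\<close> and then the robber from \<open>x \<notin> insert v K\<close> to \<open>w \<noteq> v\<close>.
\<close>

inductive clears :: "'a \<Rightarrow> 'a set \<Rightarrow> bool" where
  start: "u \<in> verts G \<Longrightarrow> clears u {u}"
| move: "clears u K \<Longrightarrow> u \<rightarrow>\<^bsub>G\<^esub> v \<Longrightarrow>
    (\<And>w. w \<in> K' \<Longrightarrow> w \<noteq> v \<Longrightarrow> w \<in> K \<and> (\<forall>x. x \<rightarrow>\<^bsub>G\<^esub> w \<longrightarrow> x \<in> insert v K)) \<Longrightarrow> clears v K'"

text \<open>Each \<open>move\<close> appends one step of the cop, who afterwards waits forever. The
  bound is strict in the second condition because the cop's move to \<open>c (Suc n)\<close> comes
  after \<open>r n\<close>.\<close>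

lemma clears_patrol:
  assumes "clears u K"
  shows "\<exists>c n. lazy_walk c \<and> c n = u \<and>
    (\<forall>r. lazy_walk r \<longrightarrow> (\<forall>m\<le>n. c m \<noteq> r m) \<longrightarrow> (\<forall>m<n. c (Suc m) \<noteq> r m) \<longrightarrow> r n \<notin> K)"
  using assms
proof induction
  case (start u)
  then show ?case
    by (intro exI[of _ "\<lambda>_. u"] exI[of _ 0]) (auto simp: lazy_walk_def)
next
  case (move u K v K')
  then obtain c n where c: "lazy_walk c" "c n = u" and
    evade: "\<And>r. lazy_walk r \<Longrightarrow> \<forall>m\<le>n. c m \<noteq> r m \<Longrightarrow> \<forall>m<n. c (Suc m) \<noteq> r m \<Longrightarrow> r n \<notin> K"
    by blast
  define c' where "c' m = (if m \<le> n then c m else v)" for m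
  have "v \<in> verts G" using \<open>u \<rightarrow>\<^bsub>G\<^esub> v\<close> adj_in_verts by blast
  have c': "lazy_walk c'"
    unfolding lazy_walk_def
  proof (intro conjI allI)
    fix m
    show "c' m \<in> verts G" using c \<open>v \<in> verts G\<close> by (simp add: c'_def lazy_walk_def)
    show "c' (Suc m) = c' m \<or> c' m \<rightarrow>\<^bsub>G\<^esub> c' (Suc m)"
      using c \<open>u \<rightarrow>\<^bsub>G\<^esub> v\<close> by (cases "m = n") (auto simp: c'_def lazy_walk_def)
  qed
  have "r (Suc n) \<notin> K'" if r: "lazy_walk r" and free: "\<forall>m\<le>Suc n. c' m \<noteq> r m"
    "\<forall>m<Suc n. c' (Suc m) \<noteq> r m" for r
  proof
    assume K': "r (Suc n) \<in> K'"
    have "\<forall>m\<le>n. c m \<noteq> r m" "\<forall>m<n. c (Suc m) \<noteq> r m"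
      using free by (auto simp: c'_def split: if_splits)
    then have "r n \<notin> K" by (rule evade[OF r])
    moreover have "r n \<noteq> v" "r (Suc n) \<noteq> v"
      using free by (auto simp: c'_def dest: spec[of _ n] spec[of _ "Suc n"])
    moreover have "r (Suc n) = r n \<or> r n \<rightarrow>\<^bsub>G\<^esub> r (Suc n)"
      using r by (simp add: lazy_walk_def)
    ultimately show False using move.hyps(3)[OF K'] by auto
  qed
  then show ?case
    using c' by (intro exI[of _ c'] exI[of _ "Suc n"]) (simp add: c'_def[of "Suc n"])
qed

lemma clears_verts_imp_winning_patrol:
  assumes "clears u (verts G)"
  shows "\<exists>c. winning_patrol 0 c"
proof -
  from clears_patrol[OF assms] obtain c n where c: "lazy_walk c" and
    n: "\<And>r. lazy_walk r \<Longrightarrow> \<forall>m\<le>n. c m \<noteq> r m \<Longrightarrow> \<forall>m<n. c (Suc m) \<noteq> r m \<Longrightarrow> r n \<notin> verts G"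
    by blast
  have "\<exists>n. c n = r n \<or> c (Suc n) = r n" if "lazy_walk r" for r
    using n[OF that] that unfolding lazy_walk_def by blast
  then show ?thesis
    unfolding winning_patrol_def using c captures_0_iff by blast
qed

section \<open>Paths in acyclic graphs\<close>

lemma reachable_del_vert_along_vpath:
  assumes "vpath p G" "i \<le> j" "j < length p" "\<And>m. i \<le> m \<Longrightarrow> m \<le> j \<Longrightarrow> p ! m \<noteq> z"
  shows "p ! i \<rightarrow>\<^sup>*\<^bsub>del_vert z\<^esub> p ! j"
proof -
  interpret D: wf_digraph "del_vert z"
    by (rule wf_digraph_del_vert)
  have p: "vwalk p G" using assms(1) by (simp add: vpath_def)
  then have V: "p ! m \<in> verts G" if "m < length p" for m
    using that by (auto simp: vwalk_def)
  show ?thesis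
    using assms(2-)
  proof (induction j rule: dec_induct)
    case base
    then show ?case using V by (intro D.reachable_refl) (simp add: del_vert_simps)
  next
    case (step j)
    have "p ! j \<rightarrow>\<^bsub>del_vert z\<^esub> p ! Suc j"
      using vwalk_nth_adj[OF p step.prems(1)] step by (auto simp: arcs_ends_del_vert)
    with step show ?case by (auto intro: D.reachable_adj_trans)
  qed
qed

text \<open>Both \<open>p ! Suc i\<close> and \<open>p ! j\<close> are neighbours of
  \<open>p ! i\<close>, joined by a segment of the path that avoids it; hence they coincide.\<close>

lemma acyclic_vpath_chordless:
  assumes acyclic: "\<nexists>p. undirected_cycle p" and p: "vpath p G"
    and "i < j" "j < length p" "p ! i \<rightarrow>\<^bsub>G\<^esub> p ! j"
  shows "j = Suc i"
proof -
  have d: "distinct p" and w: "vwalk p G" using p by (auto simp: vpath_def)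
  have "p ! Suc i \<rightarrow>\<^sup>*\<^bsub>del_vert (p ! i)\<^esub> p ! j"
    using assms d by (intro reachable_del_vert_along_vpath[OF p]) (auto simp: nth_eq_iff_index_eq)
  moreover have "p ! i \<rightarrow>\<^bsub>G\<^esub> p ! Suc i" using vwalk_nth_adj[OF w] assms by simp
  ultimately have "p ! Suc i = p ! j"
    using acyclic_unique_neighbour[OF acyclic] assms(5) by blast
  then show ?thesis using d assms by (auto simp: nth_eq_iff_index_eq)
qed

text \<open>After deleting \<open>w\<close> the path is intact and \<open>x\<close> is still on it
  or adjacent to it. So \<open>x\<close> and \<open>y\<close> are neighbours of \<open>w\<close> in
  one component of \<open>G - w\<close>.\<close>

lemma acyclic_off_vpath_leaf:
  assumes acyclic: "\<nexists>p. undirected_cycle p" and p: "vpath p G"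
    and dom: "\<And>v. v \<in> verts G \<Longrightarrow> \<exists>w\<in>set p. v = w \<or> v \<rightarrow>\<^bsub>G\<^esub> w"
    and w: "w \<notin> set p" "y \<in> set p" "y \<rightarrow>\<^bsub>G\<^esub> w" "x \<rightarrow>\<^bsub>G\<^esub> w"
  shows "x = y"
proof -
  interpret D: wf_digraph "del_vert w"
    by (rule wf_digraph_del_vert)
  have along: "u \<rightarrow>\<^sup>*\<^bsub>del_vert w\<^esub> v" if "u \<in> set p" "v \<in> set p" for u v
  proof -
    from that obtain i j where ij: "i < length p" "u = p ! i" "j < length p" "v = p ! j"
      by (metis in_set_conv_nth)
    have "p ! m \<rightarrow>\<^sup>*\<^bsub>del_vert w\<^esub> p ! n" if "m \<le> n" "n < length p" for m n
      using that w(1) by (intro reachable_del_vert_along_vpath[OF p]) auto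
    then show ?thesis
      using ij reachable_del_vert_sym by (metis nle_le)
  qed
  obtain v where v: "v \<in> set p" "x = v \<or> x \<rightarrow>\<^bsub>G\<^esub> v"
    using dom w(4) adj_in_verts by blast
  have "v \<rightarrow>\<^sup>*\<^bsub>del_vert w\<^esub> x"
  proof (cases "x = v")
    case True
    then show ?thesis using along[OF v(1) v(1)] by simp
  next
    case False
    then have "v \<rightarrow>\<^bsub>del_vert w\<^esub> x"
      using v w adj_sym adj_not_same by (auto simp: arcs_ends_del_vert)
    then show ?thesis by blast
  qed
  then have "y \<rightarrow>\<^sup>*\<^bsub>del_vert w\<^esub> x"
    using along[OF w(2) v(1)] D.reachable_trans by blast
  then show ?thesis
    using acyclic_unique_neighbour[OF acyclic] adj_sym w by blast
qed

section \<open>Sweeping a caterpillar along its backbone\<close>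

lemma caterpillar_imp_winning_patrol_0:
  assumes "caterpillar"
  shows "\<exists>c. winning_patrol 0 c"
proof -
  from assms obtain p where acyclic: "\<nexists>p. undirected_cycle p" and p: "vpath p G"
    and "\<forall>v\<in>verts G. \<exists>w\<in>set p. gdist v w \<le> 1"
    unfolding caterpillar_def undirected_tree_def by blast
  then have dom: "\<And>v. v \<in> verts G \<Longrightarrow> \<exists>w\<in>set p. v = w \<or> v \<rightarrow>\<^bsub>G\<^esub> w"
    using gdist_le_1_iff by blast
  have d: "distinct p" and w: "vwalk p G" and "p \<noteq> []" and p_V: "set p \<subseteq> verts G"
    using p by (auto simp: vpath_def vwalk_def)
  \<comment> \<open>\<open>L i\<close> are the leaves at \<open>p ! i\<close>, \<open>T i\<close> is everything that lies behind \<open>p ! i\<close>.\<close>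
  define L where "L i = {w. w \<notin> set p \<and> p ! i \<rightarrow>\<^bsub>G\<^esub> w}" for i
  define T where "T i = (\<Union>j<i. insert (p ! j) (L j))" for i
  have L_nbr: "x = p ! i" if "w \<in> L i" "x \<rightarrow>\<^bsub>G\<^esub> w" "i < length p" for x w i
    using acyclic_off_vpath_leaf[OF acyclic p dom] that by (auto simp: L_def)
  \<comment> \<open>A cop at \<open>p ! i\<close> separates \<open>T i\<close> from the rest of the
    graph.\<close>
  have T_nbr: "x \<in> insert (p ! i) (T i)" if wT: "w \<in> T i" and "x \<rightarrow>\<^bsub>G\<^esub> w" "i < length p" for x w i
  proof -
    from wT obtain j where j: "j < i" "w = p ! j \<or> w \<in> L j" by (auto simp: T_def)
    show ?thesis
    proof (cases "w = p ! j")
      case True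
      show ?thesis
      proof (cases "x \<in> set p")
        case True
        then obtain m where m: "m < length p" "x = p ! m" by (metis in_set_conv_nth)
        have "m \<le> i"
        proof (rule ccontr)
          assume "\<not> m \<le> i"
          then have "m = Suc j"
            using acyclic_vpath_chordless[OF acyclic p, of j m] m j that \<open>w = p ! j\<close> adj_sym by auto
          with j \<open>\<not> m \<le> i\<close> show False by simp
        qed
        then show ?thesis using m by (auto simp: T_def le_less)
      next
        case False
        then have "x \<in> L j" using that True adj_sym by (auto simp: L_def)
        then show ?thesis using j by (auto simp: T_def)
      qed
    next
      case False
      then have "x = p ! j" using L_nbr[of w j x] j that by auto
      then show ?thesis using j by (auto simp: T_def)
    qed
  qed
  \<comment> \<open>\<open>F\<close> collects the leaves already visited, each by an excursion from
    \<open>p ! i\<close> and back.\<close>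
  have leaves: "clears (p ! i) (insert (p ! i) (T i \<union> F))"
    if K: "clears (p ! i) (insert (p ! i) (T i))" and i: "i < length p" and "finite F" "F \<subseteq> L i" for i F
    using that(3,4)
  proof (induction F)
    case (insert l F)
    then have l: "p ! i \<rightarrow>\<^bsub>G\<^esub> l" by (auto simp: L_def)
    let ?K = "T i \<union> F"
    \<comment> \<open>With the cop at \<open>l\<close> the robber may step onto
      \<open>p ! i\<close>, so that vertex is given up; but the cop's return captures him there
      before he can go further.\<close>
    have "clears l (insert l ?K - {p ! i})"
    proof (rule clears.move)
      show "clears (p ! i) (insert (p ! i) ?K)" using insert by blast
      show "p ! i \<rightarrow>\<^bsub>G\<^esub> l" by fact
      fix w assume "w \<in> insert l ?K - {p ! i}" "w \<noteq> l"
      then show "w \<in> insert (p ! i) ?K \<and> (\<forall>x. x \<rightarrow>\<^bsub>G\<^esub> w \<longrightarrow> x \<in> insert l (insert (p ! i) ?K))"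
        using T_nbr[of w i] L_nbr[of w i] i insert.prems by blast
    qed
    then show ?case
    proof (rule clears.move)
      show "l \<rightarrow>\<^bsub>G\<^esub> p ! i" using l by (rule adj_sym)
      fix w assume w: "w \<in> insert (p ! i) (T i \<union> insert l F)" "w \<noteq> p ! i"
      have "x \<in> insert (p ! i) (insert l ?K - {p ! i})" if "x \<rightarrow>\<^bsub>G\<^esub> w" for x
        using T_nbr[of w i x] L_nbr[of w i x] i insert.prems w that by blast
      then show "w \<in> insert l ?K - {p ! i} \<and>
          (\<forall>x. x \<rightarrow>\<^bsub>G\<^esub> w \<longrightarrow> x \<in> insert (p ! i) (insert l ?K - {p ! i}))"
        using w by blast
    qed
  qed (use K in simp)
  have L_V: "L i \<subseteq> verts G" for i
    using adj_in_verts by (auto simp: L_def)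
  have T_Suc: "T (Suc i) = insert (p ! i) (T i \<union> L i)" for i
    by (auto simp: T_def less_Suc_eq)
  have finish: "clears (p ! i) (T (Suc i))"
    if "clears (p ! i) (insert (p ! i) (T i))" "i < length p" for i
    using leaves[OF that finite_subset[OF L_V finite_verts] order_refl] by (simp add: T_Suc)
  have sweep: "clears (p ! i) (insert (p ! i) (T i))" if "i < length p" for i
    using that
  proof (induction i)
    case 0
    then have "p ! 0 \<in> verts G" using p_V by auto
    then show ?case by (auto simp: T_def intro: clears.start)
  next
    case (Suc i)
    then have "clears (p ! i) (T (Suc i))" by (auto intro: finish)
    then show ?case
    \<comment> \<open>By \<open>T_nbr\<close> at \<open>Suc i\<close>, the cleared set can be
      entered only through the cop's new vertex.\<close>
    proof (rule clears.move)
      show "p ! i \<rightarrow>\<^bsub>G\<^esub> p ! Suc i" using vwalk_nth_adj[OF w] Suc by simp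
      fix w assume "w \<in> insert (p ! Suc i) (T (Suc i))" "w \<noteq> p ! Suc i"
      then show "w \<in> T (Suc i) \<and> (\<forall>x. x \<rightarrow>\<^bsub>G\<^esub> w \<longrightarrow> x \<in> insert (p ! Suc i) (T (Suc i)))"
        using T_nbr Suc by blast
    qed
  qed
  have "clears (p ! (length p - 1)) (T (length p))"
    using finish[OF sweep, of "length p - 1"] \<open>p \<noteq> []\<close> by simp
  moreover have "T (length p) = verts G"
  proof
    show "T (length p) \<subseteq> verts G" using L_V p_V by (auto simp: T_def)
    show "verts G \<subseteq> T (length p)"
    proof
      fix v assume "v \<in> verts G"
      show "v \<in> T (length p)"
      proof (cases "v \<in> set p")
        case True
        then show ?thesis by (auto simp: T_def in_set_conv_nth)
      next
        case False
        then obtain i where "i < length p" "v \<rightarrow>\<^bsub>G\<^esub> p ! i"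
          using dom[OF \<open>v \<in> verts G\<close>] by (metis in_set_conv_nth)
        then show ?thesis using False adj_sym by (auto simp: T_def L_def)
      qed
    qed
  qed
  ultimately show ?thesis
    by (intro clears_verts_imp_winning_patrol) simp
qed

end

theorem theorem8:
  fixes G :: "('a, 'b) pre_digraph"
  assumes "graph G"
    and "Digraph_Component.connected G"
  shows "graph.patrol_radius G = 0 \<longleftrightarrow> graph.caterpillar G"
proof -
  interpret graph G by fact
  show ?thesis
    using patrol_radius_eq_0_iff winning_patrol_0_imp_caterpillar
      caterpillar_imp_winning_patrol_0 assms(2) by blast
qed

end
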